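(* Let $q=p^r$ with $p$ a prime, $p>n(n+1)$, where $n\ge2$, and $q\ge5$. Let $a=-1$, $b=n(n-1)/2$, and $\mathbf{O}_n=\{x_1,\ldots,x_n\}$ with $x_1=0$ and $x_i=x_{i-1}+i-1$ for $2\le i\le n$. Let $F:\mathbb{F}_q\to\mathbb{F}_q$ be defined by $F(\delta)=(a+1)\delta+b$ for $\delta\notin\mathbf{O}_n$, $F(x_i)=ax_{i-1}+x_i+b$ for $2\le i\le n$, and $F(x_1)=0$. Then $|V_F|=n+1$; moreover exactly $q-n-1$ elements of $\mathbb{F}_q$ have no preimage under $F$, exactly $n$ elements have exactly one preimage, exactly one element has exactly $q-n$ preimages, and no element has any other number of preimages.
   Context: $V_F=\{F(c):c\in\mathbb{F}_q\}$ denotes the value set of $F$. (Here $x_n=b=-b/a$, so $F$ is of the form $f(x)+x$ where $f$ is the permutation with $f=g$ off $\mathbf{O}_n$, $f(x_i)=g(x_{i-1})$ for $i\ge2$, $f(x_1)=g(x_n)=0$, $g(x)=ax+b$.) *)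

theory Defs
  imports "HOL-Computational_Algebra.Primes" "HOL-Library.Cardinality"
begin

end

theory Submission
  imports Defs "HOL-Number_Theory.Residues"
begin

text \<open>
  The points are the triangular numbers \<open>x\<^sub>i = i (i - 1) / 2\<close>, so \<open>F\<close> is constantly \<open>b\<close> off
  \<open>O\<^sub>n\<close>, while \<open>F x\<^sub>1 = 0\<close> and \<open>F x\<^sub>i = b + (i - 1)\<close> for \<open>i \<ge> 2\<close>. All field elements involved are
  images of natural numbers below \<open>n (n + 1) / 2 < p\<close>, hence distinct in characteristic \<open>p\<close>
  whenever the naturals are. Thus \<open>F\<close> is injective on \<open>O\<^sub>n\<close> and omits \<open>b\<close> there.
\<close>

lemma of_nat_inj_on_lessThan_CHAR:
  "inj_on (of_nat :: nat \<Rightarrow> 'a :: ring_1) {..<CHAR('a)}"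
proof (rule inj_onI)
  fix i j assume "i \<in> {..<CHAR('a)}" "j \<in> {..<CHAR('a)}" "(of_nat i :: 'a) = of_nat j"
  then show "i = j"
    by (simp add: of_nat_eq_iff_cong_CHAR cong_less_modulus_unique_nat)
qed

text \<open>The characteristic of a finite field is a prime dividing its cardinality, and
  \<open>p\<close> is the only prime divisor of \<open>p ^ r\<close>.\<close>

lemma CHAR_eq_prime_if_CARD_prime_power:
  assumes "prime p" and "CARD('a :: {field, finite}) = p ^ r"
  shows "CHAR('a) = p"
proof -
  have "prime CHAR('a)"
    by (rule prime_CHAR_semidom) (simp add: finite_imp_CHAR_pos)
  moreover have "CHAR('a) dvd p ^ r"
    using CHAR_dvd_CARD[where 'a = 'a] assms(2) by simp
  ultimately show ?thesis
    using assms(1) by (meson prime_dvd_power primes_dvd_imp_eq)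
qed

lemma fibre_cards_constant_off_inj_on:
  fixes F :: "'a :: finite \<Rightarrow> 'b :: finite"
  assumes inj: "inj_on F S" and off: "\<And>c. c \<notin> S \<Longrightarrow> F c = b" and b: "b \<notin> F ` S"
    and big: "card S + 2 \<le> CARD('a)"
  shows "card (range F) = card S + 1"
    and "card {y. card {c. F c = y} = 0} = CARD('b) - card S - 1"
    and "card {y. card {c. F c = y} = 1} = card S"
    and "card {y. card {c. F c = y} = CARD('a) - card S} = 1"
    and "card {c. F c = y} \<in> {0, 1, CARD('a) - card S}"
proof -
  have fib_b: "{c. F c = b} = - S"
    using off b by auto
  have card_b: "card {c. F c = b} = CARD('a) - card S"
    unfolding fib_b by (simp add: Compl_eq_Diff_UNIV card_Diff_subset)
  have card_S: "card {c. F c = y} = 1" if y: "y \<in> F ` S" for y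
  proof -
    obtain s where s: "s \<in> S" "y = F s" using y by auto
    then have "{c. F c = y} = {s}"
      using off b inj by (auto simp: inj_on_def)
    then show ?thesis by simp
  qed
  have card_other: "card {c. F c = y} = 0" if "y \<notin> insert b (F ` S)" for y
    using that off by auto
  have fibres: "card {c. F c = y} =
      (if y = b then CARD('a) - card S else if y \<in> F ` S then 1 else 0)" for y
    using card_b card_S card_other by auto
  have card_img: "card (F ` S) = card S"
    using inj by (rule card_image)
  \<comment> \<open>A point outside \<open>S\<close> is what makes \<open>b\<close> an actual value
    of \<open>F\<close>.\<close>
  obtain c where "c \<notin> S"
    using big by (metis UNIV_I add_leD1 add_le_same_cancel1 card_mono finite
        le_zero_eq subsetI subset_antisym zero_neq_numeral)
  then have "range F = insert b (F ` S)"
    using off by (auto simp: image_iff)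
  then show "card (range F) = card S + 1"
    using b card_img by simp
  have "{y. card {c. F c = y} = 0} = - insert b (F ` S)"
    using big by (auto simp: fibres)
  then show "card {y. card {c. F c = y} = 0} = CARD('b) - card S - 1"
    using b card_img by (simp add: Compl_eq_Diff_UNIV card_Diff_subset)
  have "{y. card {c. F c = y} = 1} = F ` S"
    using big b by (auto simp: fibres split: if_splits)
  then show "card {y. card {c. F c = y} = 1} = card S"
    using card_img by simp
  have "{y. card {c. F c = y} = CARD('a) - card S} = {b}"
    using big by (auto simp: fibres split: if_splits)
  then show "card {y. card {c. F c = y} = CARD('a) - card S} = 1"
    by simp
  show "card {c. F c = y} \<in> {0, 1, CARD('a) - card S}"
    by (simp add: fibres)
qed

theorem theorem9:
  fixes p r q n :: nat
    and a b :: "'a :: {field, finite}"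
    and x :: "nat \<Rightarrow> 'a"
    and F :: "'a \<Rightarrow> 'a"
  assumes "prime p" and "q = p ^ r" and "CARD('a) = q"
    and "n \<ge> 2" and "p > n * (n + 1)" and "q \<ge> 5"
    and "a = - 1" and "b = of_nat n * (of_nat n - 1) / 2"
    and "x 1 = 0" and "\<And>i. i \<in> {2..n} \<Longrightarrow> x i = x (i - 1) + of_nat i - 1"
    and "\<And>\<delta>. \<delta> \<notin> x ` {1..n} \<Longrightarrow> F \<delta> = (a + 1) * \<delta> + b"
    and "\<And>i. i \<in> {2..n} \<Longrightarrow> F (x i) = a * x (i - 1) + x i + b"
    and "F (x 1) = 0"
  shows "card (range F) = n + 1
    \<and> card {y. card {c. F c = y} = 0} = q - n - 1
    \<and> card {y. card {c. F c = y} = 1} = n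
    \<and> card {y. card {c. F c = y} = q - n} = 1
    \<and> (\<forall>y. card {c. F c = y} \<in> {0, 1, q - n})"
proof -
  \<comment> \<open>Lifts to the naturals: \<open>T i\<close> (a triangular number) lifts
    \<open>x i\<close>, \<open>T n\<close> lifts \<open>b\<close>, and \<open>h i\<close> lifts
    \<open>F (x i)\<close>.\<close>
  define T :: "nat \<Rightarrow> nat" where "T i = \<Sum>{..<i}" for i
  define h where "h i = (if i = 1 then 0 else T n + (i - 1))" for i
  have T_Suc: "T (Suc i) = T i + i" for i
    by (simp add: T_def)
  have double_T: "2 * T i + i = i * i" for i
    by (induction i) (simp_all add: T_def)
  \<comment> \<open>The bound \<open>1 \<le> i\<close> matters, since
    \<open>T 0 = T 1 = 0\<close>.\<close>
  have T_strict: "T i < T j" if "1 \<le> i" "i < j" for i j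
    using that(2,1) by (induction rule: strict_inc_induct[of i j]) (auto simp: T_Suc)
  have "CHAR('a) = p"
    using assms(1-3) by (intro CHAR_eq_prime_if_CARD_prime_power) simp_all
  then have inj: "inj_on (of_nat :: nat \<Rightarrow> 'a) {..<p}"
    using of_nat_inj_on_lessThan_CHAR[where 'a = 'a] by simp
  \<comment> \<open>Here the size of \<open>p\<close> enters: \<open>T n + n\<close> is half of
    \<open>n * (n + 1)\<close> and exceeds every \<open>T i\<close> and \<open>h i\<close> with
    \<open>i\<close> in \<open>{1..n}\<close>.\<close>
  have small: "T n + n < p"
    using double_T[of n] assms(5) by simp
  have T_le: "T i \<le> T n" if "i \<in> {1..n}" for i
    using that T_strict[of i n] by (cases "i = n") auto
  have T_pos: "0 < T n"
    using T_strict[of 1 n] assms(4) by simp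
  have x_T: "x i = of_nat (T i)" if "1 \<le> i" "i \<le> n" for i
    using that
  proof (induction i rule: dec_induct)
    case base
    then show ?case using assms(9) by (simp add: T_def)
  next
    case (step i)
    then show ?case using assms(10)[of "Suc i"] by (simp add: T_Suc)
  qed
  \<comment> \<open>Odd characteristic is what gives the division by 2 in \<open>b\<close> its usual
    meaning.\<close>
  have "(of_nat 2 :: 'a) \<noteq> of_nat 0"
    using inj_on_eq_iff[OF inj, of 2 0] small T_pos assms(4) by simp
  then have "(2 :: 'a) \<noteq> 0" by simp
  moreover have "2 * of_nat (T n) = (of_nat n * (of_nat n - 1) :: 'a)"
    using arg_cong[OF double_T[of n], of "of_nat :: nat \<Rightarrow> 'a"]
    by (simp add: algebra_simps eq_diff_eq)
  ultimately have b_T: "b = of_nat (T n)"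
    by (simp add: assms(8) field_simps)
  have F_x: "F (x i) = of_nat (h i)" if "i \<in> {1..n}" for i
  proof (cases "i = 1")
    case True
    then show ?thesis using assms(13) by (simp add: h_def)
  next
    case False
    then have "i \<in> {2..n}" using that by simp
    then show ?thesis
      using assms(7) assms(10,12)[of i] b_T by (simp add: h_def of_nat_diff)
  qed
  have "inj_on T {1..n}"
    using T_strict by (intro linorder_inj_onI) force+
  then have "inj_on (of_nat \<circ> T :: nat \<Rightarrow> 'a) {1..n}"
    using T_le small by (intro comp_inj_on inj_on_subset[OF inj]) fastforce+
  then have x_inj: "inj_on x {1..n}"
    by (rule inj_on_cong[THEN iffD1, rotated]) (simp add: x_T)
  have h_small: "h i < p" if "i \<in> {1..n}" for i
    using that small by (auto simp: h_def)
  have "inj_on h {1..n}"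
    using T_pos by (auto simp: inj_on_def h_def split: if_splits)
  then have "inj_on (of_nat \<circ> h :: nat \<Rightarrow> 'a) {1..n}"
    using h_small by (intro comp_inj_on inj_on_subset[OF inj]) auto
  then have "inj_on (F \<circ> x) {1..n}"
    by (rule inj_on_cong[THEN iffD1, rotated]) (simp add: F_x)
  then have F_inj: "inj_on F (x ` {1..n})"
    by (rule inj_on_imageI)
  have b_notin: "b \<notin> F ` x ` {1..n}"
  proof
    assume "b \<in> F ` x ` {1..n}"
    then obtain i where i: "i \<in> {1..n}" "(of_nat (T n) :: 'a) = of_nat (h i)"
      using F_x b_T by auto
    then have "T n = h i"
      using inj_onD[OF inj i(2)] h_small[OF i(1)] small by simp
    \<comment> \<open>For \<open>i = 1\<close> this would force \<open>T n = 0\<close>, and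
      otherwise \<open>i - 1 = 0\<close>.\<close>
    then show False
      using i(1) T_pos by (auto simp: h_def split: if_splits)
  qed
  have card_x: "card (x ` {1..n}) = n"
    using card_image[OF x_inj] by simp
  have "r \<noteq> 0"
    using assms(2,6) by (intro notI) simp
  then have "p \<le> q"
    using assms(2) prime_gt_0_nat[OF assms(1)] by (simp add: self_le_power)
  \<comment> \<open>Since \<open>n \<ge> 2\<close>,
    \<open>n + 2 \<le> 2 * (n + 1) \<le> n * (n + 1)\<close>; with \<open>p \<le> q\<close> this
    leaves at least two points off the orbit.\<close>
  moreover have "n + 2 \<le> n * (n + 1)"
    using mult_le_mono[OF assms(4), of "n + 1" "n + 1"] by simp
  ultimately have "card (x ` {1..n}) + 2 \<le> CARD('a)"
    using assms(3,5) card_x by simp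
  \<comment> \<open>With \<open>a = - 1\<close> the formula for \<open>F\<close> off the orbit
    collapses to the constant \<open>b\<close>.\<close>
  then show ?thesis
    using fibre_cards_constant_off_inj_on[OF F_inj _ b_notin] assms(3,7,11) card_x
    by simp
qed

end
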